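(* Let $n$ be an odd perfect number with prime factorization $n=p_1^{\alpha_1}\cdots p_k^{\alpha_k}p_{k+1}^{\beta}$, where $p_1,\dots,p_{k+1}$ are pairwise distinct primes, the exponents are positive integers, every $\alpha_i$ ($1\le i\le k$) is even, $\beta$ is odd, and $p_{k+1}\equiv 1\pmod 8$. Then there exist indices $i,j\in\{1,\dots,k+1\}$ such that $p_i$ is a nonzero square in $\mathbb{Z}/p_j\mathbb{Z}$.
   Context: A positive integer $n$ is perfect if it equals the sum of its positive divisors $d$ with $d<n$ (the divisor $1$ being included), i.e. the sum of all positive divisors of $n$ is $2n$. An integer $a$ is a nonzero square in $\mathbb{Z}/p\mathbb{Z}$ ($p$ prime) if $p\nmid a$ and there is an integer $x$ with $x^2\equiv a\pmod p$. *)

theory Defs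
  imports "HOL-Number_Theory.Number_Theory"
begin

definition perfect :: "nat \<Rightarrow> bool"
  where "perfect n \<longleftrightarrow> n > 0 \<and> \<Sum>{d. d dvd n \<and> d < n} = n"

definition nonzero_square_mod :: "nat \<Rightarrow> int \<Rightarrow> bool"
  where "nonzero_square_mod p a \<longleftrightarrow> \<not> int p dvd a \<and> QuadRes (int p) a"

end

theory Submission
  imports Defs
begin

text \<open>
  Let \<open>p\<close> be a prime occurring in \<open>n\<close> with even exponent \<open>a\<close>. Then
  \<open>\<sigma>(p\<^sup>a) = 1 + p + \<dots> + p\<^sup>a\<close> is odd, greater than \<open>1\<close>, and divides \<open>\<sigma>(n) = 2n\<close>, so it has
  a prime factor \<open>s\<close> dividing \<open>n\<close>. Modulo \<open>s\<close> we have \<open>p\<^bsup>a+1\<^esup> = 1\<close> with \<open>a + 1\<close> odd, hence \<open>p\<close> is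
  the square of \<open>p\<^bsup>a/2+1\<^esup>\<close>. Such a \<open>p\<close> exists because a prime power is never perfect.
\<close>

text \<open>Multiplication maps pairs of divisors of \<open>a\<close> and \<open>b\<close>
  bijectively onto the divisors of \<open>a * b\<close>: coprimality makes the splitting unique, and
  the double sum then factors.\<close>

lemma sum_divisors_coprime_mult:
  fixes a b :: nat
  assumes "coprime a b" "a * b > 0"
  shows "\<Sum>{d. d dvd a * b} = \<Sum>{d. d dvd a} * \<Sum>{d. d dvd b}"
proof -
  let ?D = "\<lambda>n::nat. {d. d dvd n}"
  have inj: "inj_on (\<lambda>(d, e). d * e) (?D a \<times> ?D b)"
  proof (rule inj_onI, clarify)
    fix d e d' e' assume "d dvd a" "e dvd b" "d' dvd a" "e' dvd b" and eq: "d * e = d' * e'"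
    then have "coprime d e'" "coprime d' e"
      using assms(1) by (meson coprime_divisors)+
    then show "d = d' \<and> e = e'"
      using eq coprime_crossproduct_nat by blast
  qed
  have "?D (a * b) = (\<lambda>(d, e). d * e) ` (?D a \<times> ?D b)"
  proof (intro equalityI subsetI)
    fix d assume "d \<in> ?D (a * b)"
    then show "d \<in> (\<lambda>(d, e). d * e) ` (?D a \<times> ?D b)"
      using division_decomp[of d a b] by auto
  qed (auto intro: mult_dvd_mono)
  then have "\<Sum>(?D (a * b)) = (\<Sum>(d, e)\<in>?D a \<times> ?D b. d * e)"
    using sum.reindex[OF inj, of "\<lambda>x. x"] by (simp add: comp_def)
  then show ?thesis
    by (simp add: sum.cartesian_product sum_product)
qed

lemma sum_divisors_prime_power:
  fixes p :: nat
  assumes "prime p"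
  shows "\<Sum>{d. d dvd p ^ a} = (\<Sum>i\<le>a. p ^ i)"
proof -
  have "{d. d dvd p ^ a} = (\<lambda>i. p ^ i) ` {..a}"
    using divides_primepow_nat[OF assms] by auto
  moreover have "inj_on (\<lambda>i. p ^ i) {..a}"
    using prime_gt_1_nat[OF assms] by (simp add: inj_on_def)
  ultimately show ?thesis
    by (simp add: sum.reindex)
qed

lemma perfect_sum_divisors:
  assumes "perfect n"
  shows "\<Sum>{d. d dvd n} = 2 * n"
proof -
  have "n > 0"
    using assms by (simp add: perfect_def)
  then have "{d. d dvd n} = insert n {d. d dvd n \<and> d < n}"
    by (auto dest: dvd_imp_le)
  then show ?thesis
    using assms by (simp add: perfect_def)
qed

text \<open>For \<open>a > 0\<close>, every term of \<open>1 + p + ... + p ^ a\<close> except the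
  first is divisible by \<open>p\<close>, so the sum is 1 modulo \<open>p\<close>, while
  \<open>2 * p ^ a\<close> is 0. For \<open>a = 0\<close> the equation reads 1 = 2.\<close>

lemma not_perfect_prime_power:
  assumes "prime p"
  shows "\<not> perfect (p ^ a)"
proof
  assume "perfect (p ^ a)"
  then have eq: "(\<Sum>i\<le>a. p ^ i) = 2 * p ^ a"
    using perfect_sum_divisors sum_divisors_prime_power[OF assms] by metis
  show False
  proof (cases a)
    case (Suc b)
    have "(\<Sum>i\<le>a. p ^ i) = 1 + p * (\<Sum>i\<le>b. p ^ i)"
      unfolding Suc sum.atMost_Suc_shift by (simp add: sum_distrib_left)
    then have "p dvd 1 + p * (\<Sum>i\<le>b. p ^ i)"
      using eq Suc by simp
    then have "p dvd 1"
      using dvd_add_left_iff dvd_triv_left by blast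
    then show False
      using assms not_prime_unit by blast
  qed (use eq in simp)
qed

lemma nonzero_square_mod_of_dvd_sum_powers:
  fixes p s :: nat
  assumes "prime s" "even a" "s dvd (\<Sum>i\<le>a. p ^ i)"
  shows "nonzero_square_mod s (int p)"
proof -
  let ?S = "\<Sum>i\<le>a. int p ^ i"
  have S: "int s dvd ?S"
    using assms(3) by (metis (mono_tags, lifting) int_dvd_int_iff of_nat_power of_nat_sum sum.cong)
  have "int p ^ Suc a - 1 = (int p - 1) * ?S"
    using power_diff_1_eq[of "int p" "Suc a"] by (simp add: lessThan_Suc_atMost)
  then have dvd: "int s dvd int p ^ Suc a - 1"
    using S by simp
  \<comment> \<open>Otherwise \<open>s\<close> would divide two consecutive integers,
    \<open>p ^ Suc a\<close> and its predecessor, hence 1.\<close>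
  have "\<not> int s dvd int p"
  proof
    assume "int s dvd int p"
    then have "int s dvd int p ^ Suc a"
      by simp
    then have "int s dvd int p ^ Suc a - (int p ^ Suc a - 1)"
      using dvd dvd_diff by blast
    then show False
      using assms(1) by simp
  qed
  moreover have "QuadRes (int s) (int p)"
    unfolding QuadRes_def
  proof
    \<comment> \<open>As \<open>a\<close> is even, \<open>2 * (a div 2 + 1) = a + 2\<close>, so the
      difference is \<open>p ^ (a + 2) - p\<close>.\<close>
    have "(int p ^ (a div 2 + 1))\<^sup>2 - int p = int p * (int p ^ Suc a - 1)"
      using assms(2) by (auto elim!: evenE simp: algebra_simps power2_eq_square power_mult)
    then show "[(int p ^ (a div 2 + 1))\<^sup>2 = int p] (mod int s)"
      using dvd by (simp add: cong_iff_dvd_diff)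
  qed
  ultimately show ?thesis
    by (simp add: nonzero_square_mod_def)
qed

lemma odd_perfect_exists_nonzero_square_mod:
  fixes n p a m :: nat
  assumes "odd n" "perfect n" "n = p ^ a * m" "prime p" "\<not> p dvd m" "a > 0" "even a"
  shows "\<exists>s. prime s \<and> s dvd n \<and> nonzero_square_mod s (int p)"
proof -
  let ?S = "\<Sum>i\<le>a. p ^ i"
  have "coprime (p ^ a) m" "p ^ a * m > 0"
    using assms by (auto simp: prime_imp_coprime perfect_def)
  then have S_dvd: "?S dvd 2 * n"
    using sum_divisors_coprime_mult[of "p ^ a" m] perfect_sum_divisors[OF assms(2)]
      sum_divisors_prime_power[OF assms(4)] assms(3) by (metis dvd_triv_left)
  have "odd p"
    using assms by auto
  \<comment> \<open>There are \<open>a + 1\<close> terms, an odd number, and each is odd.\<close>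
  then have "odd ?S"
    using assms(7) by (simp add: even_sum_iff)
  moreover have "?S \<noteq> 1"
  proof -
    \<comment> \<open>Since \<open>a > 0\<close>, the terms for the exponents 0 and 1 both
      occur.\<close>
    have "1 + p \<le> ?S"
      using sum_mono2[of "{..a}" "{0, 1}" "\<lambda>i. p ^ i"] assms(6) by simp
    then show ?thesis
      using prime_gt_0_nat[OF assms(4)] by linarith
  qed
  then obtain s where s: "prime s" "s dvd ?S"
    using prime_factor_nat by blast
  ultimately have "s \<noteq> 2"
    by auto
  then have "s dvd n"
    using s S_dvd by (metis dvd_trans prime_dvd_mult_iff primes_dvd_imp_eq two_is_prime_nat)
  then show ?thesis
    using s nonzero_square_mod_of_dvd_sum_powers assms(7) by blast
qed

theorem mainTheorem2:
  fixes n k \<beta> :: nat and p \<alpha> :: "nat \<Rightarrow> nat"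
  assumes "odd n" and "perfect n"
    and "n = (\<Prod>i\<in>{1..k}. p i ^ \<alpha> i) * p (k + 1) ^ \<beta>"
    and "\<And>i. i \<in> {1..k + 1} \<Longrightarrow> prime (p i)"
    and "inj_on p {1..k + 1}"
    and "\<And>i. i \<in> {1..k} \<Longrightarrow> \<alpha> i > 0 \<and> even (\<alpha> i)"
    and "\<beta> > 0" and "odd \<beta>"
    and "[p (k + 1) = 1] (mod 8)"
  shows "\<exists>i\<in>{1..k + 1}. \<exists>j\<in>{1..k + 1}. nonzero_square_mod (p j) (int (p i))"
proof -
  \<comment> \<open>With \<open>k = 0\<close>, \<open>n\<close> would be a power of the single prime
    \<open>p 1\<close>. So \<open>p 1\<close> has an even exponent and can serve as the prime that
    becomes a square.\<close>
  have "k \<noteq> 0"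
  proof
    assume "k = 0"
    then show False
      using assms(2,3) assms(4)[of 1] not_perfect_prime_power by simp
  qed
  define m where "m = (\<Prod>i\<in>{2..k}. p i ^ \<alpha> i) * p (k + 1) ^ \<beta>"
  have "{1..k} = insert 1 {2..k}"
    using \<open>k \<noteq> 0\<close> by auto
  then have n: "n = p 1 ^ \<alpha> 1 * m"
    using assms(3) by (simp add: m_def)
  \<comment> \<open>Stated for a general \<open>A\<close> because it is used twice:
    \<open>{2..k}\<close> shows that \<open>p 1\<close> does not divide the cofactor
    \<open>m\<close>, and \<open>{1..k}\<close> finds the modulus \<open>s\<close> among the primes
    of \<open>n\<close>.\<close>
  have dvdD: "\<exists>j\<in>A \<union> {k + 1}. s = p j"
    if s: "prime s" "s dvd (\<Prod>i\<in>A. p i ^ \<alpha> i) * p (k + 1) ^ \<beta>" and A: "A \<subseteq> {1..k}" for s A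
  proof -
    have "finite A"
      using A finite_subset by blast
    then obtain j where j: "j \<in> A \<union> {k + 1}" "s dvd p j"
      using s by (auto simp: prime_dvd_mult_iff prime_dvd_prod_iff dest: prime_dvd_power)
    then have "prime (p j)"
      using A assms(4) by auto
    then show ?thesis
      using j s(1) primes_dvd_imp_eq by blast
  qed
  have "\<not> p 1 dvd m"
  proof
    assume "p 1 dvd m"
    moreover have "prime (p 1)" "{2..k} \<subseteq> {1..k}"
      using assms(4)[of 1] by auto
    ultimately obtain j where "j \<in> {2..k} \<union> {k + 1}" "p 1 = p j"
      using dvdD[of "p 1" "{2..k}"] unfolding m_def by blast
    \<comment> \<open>Here \<open>j\<close> differs from 1, as \<open>k + 1 > 1\<close>, so
      \<open>p 1 = p j\<close> contradicts injectivity.\<close>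
    then show False
      using inj_onD[OF assms(5), of 1 j] \<open>k \<noteq> 0\<close> by auto
  qed
  then obtain s where s: "prime s" "s dvd n" "nonzero_square_mod s (int (p 1))"
    using odd_perfect_exists_nonzero_square_mod[OF assms(1,2) n] assms(4)[of 1] assms(6)[of 1] \<open>k \<noteq> 0\<close>
    by auto
  then obtain j where "j \<in> {1..k} \<union> {k + 1}" "s = p j"
    using dvdD[of s "{1..k}"] assms(3) by blast
  then have "j \<in> {1..k + 1}"
    by auto
  moreover have "1 \<in> {1..k + 1}"
    by simp
  ultimately show ?thesis
    using s(3) \<open>s = p j\<close> by blast
qed

end
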